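(* Let $L$ be a multiset of odd integers greater than $1$, let $a\in\{0,1\}$, and set $\epsilon_1=7^{|L|+a-1}\big(2\max(L)+1\big)$ if $L\ne\emptyset$ and $\epsilon_1=3$ if $L=\emptyset$. Then for every $\epsilon\ge 3\epsilon_1$ there exists a graceful labeling $\Gamma_\epsilon$ of $\left[L,{}^a2\ \middle|\ \epsilon-\sum_{\ell\in L}\ell-2a\right]_\epsilon$ such that $\Delta_p\Gamma_\epsilon\supseteq\mathcal{I}(\epsilon_1+1,\epsilon)$.
   Context: $\mathcal{I}(a,b)=\{x\in\mathbb{Z}\mid a\le x\le b\}$; $|L|$ counts multiplicity. $[L,{}^a2\mid m]$ is the vertex-disjoint union of one $\ell$-cycle for each $\ell\in L$, $a$ cycles of length $2$ (two vertices joined by two parallel edges), and a path with $m$ edges; the subscript $\epsilon$ is the number of edges. A labeling is an isomorphic copy with distinct integer vertices; $\Delta\Gamma$ is the multiset of differences $u-w$ over ordered pairs of adjacent vertices (parallel edges counted separately), and $\Delta_p\Gamma$ is the same restricted to edges of the path. A graceful labeling of such a graph with $\epsilon$ edges is a labeling $\Gamma$ with vertex set $\mathcal{I}(0,\epsilon)$ such that $\Delta\Gamma=\pm\mathcal{I}(1,\epsilon)$ if there is no $2$-cycle, and $\Delta\Gamma=\pm\{1,3,3\}\cup\pm\mathcal{I}(4,\epsilon)$ (as multisets) if there is exactly one $2$-cycle. *)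

theory Defs
  imports Complex_Main "HOL-Library.Multiset"
begin

text \<open>
  Loopless multigraphs: an edge is the two-element set of its ends, and parallel edges
  are occurrences of the same set in the multiset \<open>edges\<close>.  The edges of the distinguished
  path are recorded in \<open>path_edges\<close>, a sub-multiset of \<open>edges\<close>.
\<close>

record 'v cp_graph =
  verts :: "'v set"
  edges :: "'v set multiset"
  path_edges :: "'v set multiset"

text \<open>
  The vertices of the model of \<open>[L, \<^sup>a2 | m]\<close> are pairs (component, position).  Component 0 is the
  path; the other components are the cycles, in some order.  For \<open>l = 2\<close> the edge \<open>{(j,0),(j,1)}\<close>
  occurs twice in \<open>cycle_edges j l\<close>, as required.
\<close>

definition cycle_edges :: "nat \<Rightarrow> nat \<Rightarrow> (nat \<times> nat) set multiset" where
  "cycle_edges j l = {# {(j, i), (j, Suc i mod l)}. i \<in># mset_set {..<l} #}"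

definition path_edges_of_length :: "nat \<Rightarrow> (nat \<times> nat) set multiset" where
  "path_edges_of_length m = {# {(0, i), (0, Suc i)}. i \<in># mset_set {..<m} #}"

definition cycle_lengths :: "nat multiset \<Rightarrow> nat \<Rightarrow> nat list" where
  "cycle_lengths L a = sorted_list_of_multiset L @ replicate a 2"

definition cycles_and_path :: "nat multiset \<Rightarrow> nat \<Rightarrow> nat \<Rightarrow> (nat \<times> nat) cp_graph" where
  "cycles_and_path L a m = (let ls = cycle_lengths L a in
     \<lparr> verts = {0} \<times> {..m} \<union> (\<Union>j<length ls. {Suc j} \<times> {..<ls ! j}),
       edges = path_edges_of_length m + (\<Sum>j<length ls. cycle_edges (Suc j) (ls ! j)),
       path_edges = path_edges_of_length m \<rparr>)"

definition relabel :: "('v \<Rightarrow> 'w) \<Rightarrow> 'v cp_graph \<Rightarrow> 'w cp_graph" where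
  "relabel f G = \<lparr> verts = f ` verts G,
                   edges = image_mset (image f) (edges G),
                   path_edges = image_mset (image f) (path_edges G) \<rparr>"

definition labeling_of :: "int cp_graph \<Rightarrow> 'v cp_graph \<Rightarrow> bool" where
  "labeling_of \<Gamma> G \<longleftrightarrow> (\<exists>f. inj_on f (verts G) \<and> \<Gamma> = relabel f G)"

definition edge_differences :: "int set multiset \<Rightarrow> int multiset" where
  "edge_differences E =
     (\<Sum>e\<in>#E. {# u - w. (u, w) \<in># mset_set {(u, w) \<in> e \<times> e. u \<noteq> w} #})"

definition Delta :: "int cp_graph \<Rightarrow> int multiset" where
  "Delta \<Gamma> = edge_differences (edges \<Gamma>)"

definition Delta_path :: "int cp_graph \<Rightarrow> int multiset" where
  "Delta_path \<Gamma> = edge_differences (path_edges \<Gamma>)"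

definition plus_minus :: "int multiset \<Rightarrow> int multiset" where
  "plus_minus A = A + image_mset uminus A"

text \<open>
  Here \<open>a\<close> counts all the 2-cycles (\<open>L\<close> is meant to have no element 2).  Gracefulness is
  defined only for at most one 2-cycle, so the predicate is false for \<open>a > 1\<close>.
\<close>

definition graceful_labeling_of ::
  "int cp_graph \<Rightarrow> nat multiset \<Rightarrow> nat \<Rightarrow> nat \<Rightarrow> bool" where
  "graceful_labeling_of \<Gamma> L a m \<longleftrightarrow>
     labeling_of \<Gamma> (cycles_and_path L a m) \<and>
     (let \<epsilon> = int (size (edges \<Gamma>)) in
        verts \<Gamma> = {0..\<epsilon>} \<and>
        (a = 0 \<and> Delta \<Gamma> = plus_minus (mset_set {1..\<epsilon>}) \<or>
         a = 1 \<and> Delta \<Gamma> = plus_minus {#1, 3, 3#} + plus_minus (mset_set {4..\<epsilon>})))"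

end

theory Submission
  imports Defs
begin

text \<open>
  The labelling grows outwards from a block \<open>lo, \<dots>, lo + k\<close> that is already labelled gracefully and in
  which the path ends at distance \<open>D\<close> (its depth) from an end of the block.  New vertices are added on
  both sides; taken alternately from the left and the right they carry the numbers ("times")
  \<open>1, 2, 3, \<dots>\<close>, and two of them on different sides with times \<open>s\<close>, \<open>t\<close> differ by \<open>k + (s + t + 1)/2\<close>.
  Labelling problems thus become problems about permutations of \<open>1, \<dots>, n\<close> that alternate in parity,
  use each label \<open>(s + t + 1)/2\<close> in \<open>2, \<dots>, n\<close> once, and start at a prescribed place; these are solved
  by a Euclid-like recursion.

  Prolonging the path keeps its depth.  A cycle of length \<open>2r + 1\<close> is added from the times
  \<open>1, \<dots>, 2r\<close> and one more left vertex, at distance \<open>k + 1\<close> from the first; what remains splits into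
  three alternating paths.  This turns \<open>(k, D)\<close> into \<open>(5k + 2D + 5, k + D + 1)\<close>, whence the factor 7.
\<close>

section \<open>Alternating permutations with a prescribed start\<close>

fun labels :: "nat list \<Rightarrow> nat multiset" where
  "labels (a # b # ts) = add_mset ((a + b + 1) div 2) (labels (b # ts))"
| "labels _ = {#}"

fun alternating :: "nat list \<Rightarrow> bool" where
  "alternating (a # b # ts) \<longleftrightarrow> odd (a + b) \<and> alternating (b # ts)"
| "alternating _ = True"

lemma labels_append:
  "xs \<noteq> [] \<Longrightarrow> ys \<noteq> [] \<Longrightarrow>
    labels (xs @ ys) = add_mset ((last xs + hd ys + 1) div 2) (labels xs + labels ys)"
proof (induction xs rule: labels.induct)
  case ("2_2" v)
  then show ?case by (cases ys) auto
qed auto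

lemma alternating_append:
  "xs \<noteq> [] \<Longrightarrow> ys \<noteq> [] \<Longrightarrow>
    alternating (xs @ ys) \<longleftrightarrow> alternating xs \<and> alternating ys \<and> odd (last xs + hd ys)"
proof (induction xs rule: alternating.induct)
  case ("2_2" v)
  then show ?case by (cases ys) auto
qed auto

lemma labels_rev: "labels (rev xs) = labels xs"
proof (induction xs rule: labels.induct)
  case (1 a b ts)
  have "labels (rev (a # b # ts)) = labels (rev (b # ts) @ [a])" by simp
  also have "\<dots> = add_mset ((a + b + 1) div 2) (labels (rev (b # ts)))"
    by (subst labels_append) (auto simp: add_ac)
  finally show ?case using 1 by simp
qed auto

lemma alternating_rev: "alternating (rev xs) \<longleftrightarrow> alternating xs"
proof (induction xs rule: alternating.induct)
  case (1 a b ts)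
  have "alternating (rev (a # b # ts)) \<longleftrightarrow> alternating (rev (b # ts) @ [a])" by simp
  also have "\<dots> \<longleftrightarrow> alternating (rev (b # ts)) \<and> odd (a + b)"
    by (subst alternating_append) (auto simp: add_ac)
  finally show ?case using 1 by auto
qed auto

text \<open>Moving both times by \<open>c\<close> moves their label by \<open>c\<close>. An odd
  \<open>c\<close> exchanges left and right everywhere, which keeps alternation; solutions can thus
  be moved to any later interval.\<close>

lemma labels_map_add: "labels (map ((+) c) ts) = image_mset ((+) c) (labels ts)"
proof (induction ts rule: labels.induct)
  case (1 a b ts)
  have "(c + a + (c + b) + 1) div 2 = c + (a + b + 1) div 2" by presburger
  with 1 show ?case by simp
qed auto

lemma alternating_map_add: "alternating (map ((+) c) ts) \<longleftrightarrow> alternating ts"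
  by (induction ts rule: alternating.induct) auto

lemma count_interval [simp]:
  "count (mset_set {a..b::nat}) x = (if a \<le> x \<and> x \<le> b then 1 else 0)"
  "count (mset_set {a<..<b::nat}) x = (if a < x \<and> x < b then 1 else 0)"
  "count (mset_set {a..<b::nat}) x = (if a \<le> x \<and> x < b then 1 else 0)"
  by (auto simp: count_mset_set')

text \<open>Neighbours \<open>t\<close>, \<open>t + 1\<close> have label \<open>t + 1\<close>, so a
  run of consecutive times uses its own times, except the smallest, as labels.\<close>

lemma labels_upt: "labels [a..<b] = mset_set {a<..<b}"
proof (induction b)
  case (Suc b)
  show ?case
  proof (cases "a < b")
    case True
    with Suc show ?thesis by (auto simp: labels_append intro!: multiset_eqI)
  qed (auto intro!: multiset_eqI)
qed auto

lemma alternating_upt: "alternating [a..<b]"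
proof (induction b)
  case (Suc b)
  then show ?case by (cases "a < b") (auto simp: alternating_append)
qed auto

lemma mset_set_shift:
  fixes a b c :: nat
  shows "image_mset ((+) c) (mset_set {a..b}) = mset_set {c + a..c + b}"
    and "image_mset ((+) c) (mset_set {a..<b}) = mset_set {c + a..<c + b}"
    and "image_mset ((+) c) (mset_set {a<..<b}) = mset_set {c + a<..<c + b}"
  by (simp_all add: image_mset_mset_set add.commute flip: atLeastSucLessThan_greaterThanLessThan)

lemma mset_set_split:
  fixes a b c :: nat
  assumes "a \<le> b" "b \<le> c"
  shows "mset_set {a..<c} = mset_set {a..<b} + mset_set {b..<c}"
  using assms by (auto intro!: multiset_eqI)

text \<open>Up to the names of the vertices, an alpha-labelling of a path on \<open>n\<close>
  vertices with a prescribed end. Summing all labels gives \<open>hd ts + last ts = n + 1\<close>,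
  whence the value of the other end.\<close>

definition alpha_path :: "nat \<Rightarrow> nat \<Rightarrow> nat list \<Rightarrow> bool" where
  "alpha_path n s ts \<longleftrightarrow> ts \<noteq> [] \<and> mset ts = mset_set {1..n} \<and> alternating ts \<and>
     labels ts = mset_set {2..n} \<and> hd ts = s \<and> last ts = n + 1 - s"

lemma alpha_path_one: "n \<ge> 1 \<Longrightarrow> alpha_path n 1 [1..<n + 1]"
  unfolding alpha_path_def
  by (auto simp: labels_upt alternating_upt simp del: upt_Suc
      intro!: multiset_eqI)

section \<open>Reversal of the order of the times\<close>

lemma image_mset_reflect:
  fixes a b c :: nat
  assumes "b \<le> c"
  shows "image_mset (\<lambda>t. c - t) (mset_set {a..b}) = (if a \<le> b then mset_set {c - b..c - a} else {#})"
proof -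
  have "inj_on (\<lambda>t. c - t) {a..b}" using assms by (auto simp: inj_on_def)
  moreover have "(\<lambda>t. c - t) ` {a..b} = {c - b..c - a}" if "a \<le> b"
  proof (intro equalityI subsetI)
    fix x assume "x \<in> {c - b..c - a}"
    then show "x \<in> (\<lambda>t. c - t) ` {a..b}"
      using assms that by (intro image_eqI[of _ _ "c - x"]) auto
  qed (use assms in auto)
  ultimately show ?thesis by (simp add: image_mset_mset_set)
qed

lemma reflect_labels:
  assumes "\<forall>t\<in>set ts. t \<le> c" "alternating ts"
  shows "alternating (map (\<lambda>t. c - t) ts) \<and>
    labels (map (\<lambda>t. c - t) ts) = image_mset (\<lambda>l. c + 1 - l) (labels ts)"
  using assms
proof (induction ts rule: labels.induct)
  case (1 a b ts)
  have ab: "odd (a + b)" "a + b \<le> 2 * c" "c - a + (c - b) = 2 * c - (a + b)" using "1.prems" by auto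
  from ab(1) obtain h where h: "a + b = 2 * h + 1" by (rule oddE)
  have "odd (c - a + (c - b))" "(c - a + (c - b) + 1) div 2 = c + 1 - (a + b + 1) div 2"
    using ab h by simp_all
  then show ?case using 1 by simp
qed auto

text \<open>Reversal exchanges \<open>s\<close> and \<open>n + 1 - s\<close> and sends a label
  \<open>l\<close> to \<open>n + 2 - l\<close>, so the label set \<open>{2..n}\<close> is
  preserved.\<close>

lemma alpha_path_reflect:
  assumes "alpha_path n s ts" "1 \<le> s" "s \<le> n"
  shows "alpha_path n (n + 1 - s) (map (\<lambda>t. n + 1 - t) ts)"
proof -
  have ts: "mset ts = mset_set {1..n}" "alternating ts" "labels ts = mset_set {2..n}"
    "hd ts = s" "last ts = n + 1 - s" "ts \<noteq> []"
    using assms by (auto simp: alpha_path_def)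
  have "set ts = {1..n}" using ts(1) by (metis finite_atLeastAtMost finite_set_mset_mset_set set_mset_mset)
  then have le: "\<forall>t\<in>set ts. t \<le> n + 1" by auto
  then show ?thesis
    using reflect_labels[OF le ts(2)] ts assms image_mset_reflect[of n "n + 1" 1]
       image_mset_reflect[of n "n + 2" 2]
    by (auto simp: alpha_path_def hd_map last_map)
qed

text \<open>
  \<open>double_block i\<close> is \<open>2i-1, 2i, 2i-3, 2i-2, \<dots>, 1, 2\<close>: a descending zigzag that starts at an odd
  number and nevertheless exhausts an interval of even length.
\<close>

fun double_block :: "nat \<Rightarrow> nat list" where
  "double_block 0 = []"
| "double_block (Suc i) = [2 * i + 1, 2 * i + 2] @ double_block i"

lemma hd_double_block: "i \<ge> 1 \<Longrightarrow> double_block i \<noteq> [] \<and> hd (double_block i) = 2 * i - 1"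
  by (cases i) auto

lemma double_block:
  assumes "i \<ge> 1"
  shows "last (double_block i) = 2 \<and> alternating (double_block i) \<and>
    mset (double_block i) = mset_set {1..2 * i} \<and> labels (double_block i) = mset_set {2..2 * i}"
  using assms
proof (induction i rule: nat_induct_at_least)
  case base
  show ?case by (auto intro!: multiset_eqI)
next
  case (Suc i)
  \<comment> \<open>The new pair has label \<open>2 * i + 2\<close> and its join to the rest has
    label \<open>2 * i + 1\<close>: the two new labels.\<close>
  have join: "2 * i + 2 + hd (double_block i) = 4 * i + 1"
    using hd_double_block[OF Suc.hyps] Suc.hyps by simp
  have "alternating ([2 * i + 1, 2 * i + 2] @ double_block i)"
    using Suc hd_double_block[OF Suc.hyps] join by (subst alternating_append) auto
  moreover have "labels ([2 * i + 1, 2 * i + 2] @ double_block i) = mset_set {2..2 * Suc i}"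
    using Suc hd_double_block[OF Suc.hyps] join by (subst labels_append) (auto intro!: multiset_eqI)
  moreover have "mset ([2 * i + 1, 2 * i + 2] @ double_block i) = mset_set {1..2 * Suc i}"
    using Suc by (auto intro!: multiset_eqI)
  ultimately show ?case
    using Suc hd_double_block[OF Suc.hyps] by simp
qed

text \<open>
  A descending block that exhausts \<open>1..m\<close> leaves the same kind of problem on the remaining
  interval, entered at the same relative position.
\<close>

lemma alpha_path_prepend:
  assumes block: "bs \<noteq> []" "mset bs = mset_set {1..m}" "alternating bs" "labels bs = mset_set {2..m}"
    and m: "last bs + s = m + 1" "hd bs = s" "m \<ge> 1"
    and rest: "alpha_path n s ts" "n \<ge> 1"
  shows "alpha_path (m + n) s (bs @ map ((+) m) ts)"
proof -
  have ts: "mset ts = mset_set {1..n}" "alternating ts" "labels ts = mset_set {2..n}"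
    "hd ts = s" "last ts = n + 1 - s" "ts \<noteq> []"
    using rest by (auto simp: alpha_path_def)
  have "s \<le> n"
    using ts(1,4,6) by (metis atLeastAtMost_iff finite_atLeastAtMost finite_set_mset_mset_set hd_in_set set_mset_mset)
  \<comment> \<open>The join has label \<open>m + 1\<close>, the one missing between the labels of
    the block and those of the shifted rest.\<close>
  have join: "last bs + hd (map ((+) m) ts) = 2 * m + 1"
    using m ts by (simp add: hd_map)
  have "alternating (bs @ map ((+) m) ts)"
    using block ts join by (simp add: alternating_append alternating_map_add)
  moreover have "labels (bs @ map ((+) m) ts) = mset_set {2..m + n}"
    using block ts join m rest(2)
    by (subst labels_append) (auto simp: labels_map_add mset_set_shift simp del: add_Suc intro!: multiset_eqI)
  moreover have "mset (bs @ map ((+) m) ts) = mset_set {1..m + n}"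
    using block ts by (auto simp: mset_set_shift intro!: multiset_eqI)
  ultimately show ?thesis
    using \<open>s \<le> n\<close> block ts m unfolding alpha_path_def by (simp add: last_map)
qed

text \<open>For odd \<open>n\<close> there is one more odd time than even ones, so both ends are
  odd, and for \<open>n > 1\<close> they differ, which excludes \<open>2 * s = n + 1\<close>. These
  necessary conditions suffice: after a reflection \<open>2 * s \<le> n\<close>, and splitting off a
  block of about \<open>s\<close> times leaves the same \<open>s\<close> with a smaller
  \<open>n\<close>.\<close>

lemma alpha_path_exists:
  assumes "1 \<le> s" "s \<le> n" "even n \<or> n = 1 \<or> (odd s \<and> 2 * s \<noteq> n + 1)"
  shows "\<exists>ts. alpha_path n s ts"
  using assms
proof (induction n arbitrary: s rule: less_induct)
  case (less n)
  have half: "\<exists>ts. alpha_path n s ts"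
    if s: "1 \<le> s" "2 * s \<le> n" "even n \<or> odd s" for s
  proof (cases "s = 1")
    case True
    with s show ?thesis using alpha_path_one[of n] by auto
  next
    case False
    show ?thesis
    \<comment> \<open>In this case a descending run of length \<open>s\<close> would leave
      \<open>2 * s - 1\<close> times with \<open>s\<close> at their midpoint, which is excluded. A
      double block has one time more and leaves an even number.\<close>
    proof (cases "even n \<and> odd s \<and> n + 1 = 3 * s")
      case True
      obtain j where "s = 2 * j + 1" using True by (auto elim: oddE)
      then obtain i where i: "2 * i = s + 1" "i \<ge> 1" by (intro that[of "j + 1"]) auto
      have n: "n = 2 * i + (2 * s - 2)" using True i s by linarith
      have "2 * s - 2 < n" "s \<le> 2 * s - 2" using n i s \<open>s \<noteq> 1\<close> by linarith+
      then obtain ts where "alpha_path (2 * s - 2) s ts"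
        using less.IH[of "2 * s - 2" s] s(1) by auto
      then have "alpha_path (2 * i + (2 * s - 2)) s (double_block i @ map ((+) (2 * i)) ts)"
        using double_block[OF i(2)] hd_double_block[OF i(2)] i s \<open>s \<noteq> 1\<close>
        by (intro alpha_path_prepend) auto
      then show ?thesis using n by auto
    next
      case False
      \<comment> \<open>The run \<open>s, ..., 1\<close> is split off, one subtraction of Euclid's
        algorithm; only the case just treated could violate the conditions on the rest.\<close>
      have "\<exists>ts. alpha_path (n - s) s ts"
      proof (cases "n = 2 * s")
        case True
        then show ?thesis using less.IH[of "n - s" s] s False \<open>s \<noteq> 1\<close> by simp
      next
        case False
        have "even (n - s) \<or> odd s \<and> 2 * s \<noteq> n - s + 1"
        proof (cases "even s")
          case True
          then show ?thesis using s by simp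
        next
          case False
          then show ?thesis using \<open>\<not> (even n \<and> odd s \<and> n + 1 = 3 * s)\<close> s by (cases "even n") auto
        qed
        moreover have "n - s < n" "s \<le> n - s" using s by linarith+
        ultimately show ?thesis using less.IH[of "n - s" s] s(1) by blast
      qed
      then obtain ts where "alpha_path (n - s) s ts" by auto
      then have "alpha_path (s + (n - s)) s (rev [1..<s + 1] @ map ((+) s) ts)"
        using s by (intro alpha_path_prepend)
         (auto simp: labels_rev alternating_rev labels_upt alternating_upt
            hd_rev last_rev simp del: upt_Suc intro!: multiset_eqI)
      then show ?thesis using s by auto
    qed
  qed
  consider "n = 1" | "2 * s \<le> n" "n \<noteq> 1" | "2 * s > n + 1" "n \<noteq> 1"
    using less.prems by fastforce
  then show ?case
  proof cases
    case 1
    then show ?thesis using less.prems alpha_path_one[of 1] by auto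
  next
    case 2
    then show ?thesis using half less.prems by auto
  next
    case 3
    have "2 * (n + 1 - s) \<le> n" "1 \<le> n + 1 - s" "n + 1 - s \<le> n" "n + 1 - (n + 1 - s) = s"
      using 3 less.prems by linarith+
    moreover have "even n \<or> odd (n + 1 - s)" using 3 less.prems by auto
    ultimately show ?thesis
      using half[of "n + 1 - s"] alpha_path_reflect[of n "n + 1 - s"] by metis
  qed
qed

section \<open>Extending a labelled block\<close>

fun path_diffs :: "int list \<Rightarrow> int multiset" where
  "path_diffs (x # y # xs) = add_mset \<bar>x - y\<bar> (path_diffs (y # xs))"
| "path_diffs _ = {#}"

definition cycle_diffs :: "int list \<Rightarrow> int multiset" where
  "cycle_diffs c = path_diffs (c @ [hd c])"

lemma path_diffs_append:
  "xs \<noteq> [] \<Longrightarrow> ys \<noteq> [] \<Longrightarrow>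
    path_diffs (xs @ ys) = add_mset \<bar>last xs - hd ys\<bar> (path_diffs xs + path_diffs ys)"
proof (induction xs rule: path_diffs.induct)
  case ("2_2" v)
  then show ?case by (cases ys) auto
qed auto

lemma path_diffs_uminus: "path_diffs (map uminus xs) = path_diffs xs"
  by (induction xs rule: path_diffs.induct) auto

lemma cycle_diffs_uminus: "c \<noteq> [] \<Longrightarrow> cycle_diffs (map uminus c) = cycle_diffs c"
  using path_diffs_uminus[of "c @ [hd c]"] by (simp add: cycle_diffs_def hd_map)

section \<open>From times to integer vertices\<close>

definition vertex :: "int \<Rightarrow> nat \<Rightarrow> nat \<Rightarrow> int" where
  "vertex lo k t = (if odd t then lo - int ((t + 1) div 2) else lo + int k + int (t div 2))"

lemma vertex_diff:
  assumes "odd (s + t)"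
  shows "\<bar>vertex lo k s - vertex lo k t\<bar> = int (k + (s + t + 1) div 2)"
proof (cases "odd s")
  case True
  then obtain i where "s = 2 * i + 1" by (rule oddE)
  moreover from True assms have "even t" by simp
  then obtain j where "t = 2 * j" by (rule evenE)
  ultimately show ?thesis by (simp add: vertex_def)
next
  case False
  then obtain i where "s = 2 * i" by (auto elim: evenE)
  moreover from False assms have "odd t" by simp
  then obtain j where "t = 2 * j + 1" by (rule oddE)
  ultimately show ?thesis by (simp add: vertex_def)
qed

lemma path_diffs_vertex:
  "alternating ts \<Longrightarrow> path_diffs (map (vertex lo k) ts) = image_mset (\<lambda>l. int (k + l)) (labels ts)"
proof (induction ts rule: labels.induct)
  case (1 a b ts)
  then show ?case using vertex_diff[of a b lo k] by simp
qed auto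

lemma mset_interval_insert_right: "l \<le> h + 1 \<Longrightarrow> mset_set {l..h + 1 :: int} = add_mset (h + 1) (mset_set {l..h})"
proof -
  assume "l \<le> h + 1"
  then have "{l..h + 1} = insert (h + 1) {l..h}" by auto
  then show ?thesis by simp
qed

lemma mset_interval_insert_left: "l \<le> h + 1 \<Longrightarrow> mset_set {l - 1..h :: int} = add_mset (l - 1) (mset_set {l..h})"
proof -
  assume "l \<le> h + 1"
  then have "{l - 1..h} = insert (l - 1) {l..h}" by auto
  then show ?thesis by simp
qed

lemma vertex_interval:
  "mset_set {lo..lo + int k} + image_mset (vertex lo k) (mset_set {1..N}) =
    mset_set {lo - int ((N + 1) div 2)..lo + int k + int (N div 2)}"
proof (induction N)
  case (Suc N)
  have "{1..Suc N} = insert (Suc N) {1..N}" by auto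
  then have step: "mset_set {lo..lo + int k} + image_mset (vertex lo k) (mset_set {1..Suc N}) =
      add_mset (vertex lo k (Suc N)) (mset_set {lo - int ((N + 1) div 2)..lo + int k + int (N div 2)})"
    using Suc.IH by simp
  show ?case
  proof (cases "odd N")
    case True
    then obtain i where "N = 2 * i + 1" by (rule oddE)
    then show ?thesis
      using mset_interval_insert_right[of "lo - int i - 1" "lo + int k + int i"]
      unfolding step by (simp add: vertex_def algebra_simps)
  next
    case False
    then obtain i where "N = 2 * i" by (auto elim: evenE)
    then show ?thesis
      using mset_interval_insert_left[of "lo - int i" "lo + int k + int i"]
      unfolding step by (simp add: vertex_def algebra_simps)
  qed
qed simp

text \<open>The positive half of the required differences. For \<open>a = 1\<close> it has
  \<open>k\<close> elements only from \<open>k = 3\<close> on.\<close>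

definition diff_target :: "nat \<Rightarrow> nat \<Rightarrow> int multiset" where
  "diff_target a k = (if a = 0 then mset_set {1..int k} else {#1, 3, 3#} + mset_set {4..int k})"

lemma diff_target_add:
  assumes "a = 0 \<or> 3 \<le> k"
  shows "diff_target a (k + N) = diff_target a k + image_mset (\<lambda>l. int (k + l)) (mset_set {1..N})"
proof (induction N)
  case (Suc N)
  have "{1..Suc N} = insert (Suc N) {1..N}" by auto
  with Suc assms show ?case
    using mset_interval_insert_right[of 1 "int (k + N)"] mset_interval_insert_right[of 4 "int (k + N)"]
    by (auto simp: diff_target_def algebra_simps)
qed simp

text \<open>A graceful labelling up to translation, each component given by its vertices in order.
  The path has one edge fewer than vertices, so \<open>k + 1\<close> vertices mean \<open>k\<close>
  edges.\<close>

definition labelled :: "int list list \<Rightarrow> int list \<Rightarrow> int \<Rightarrow> nat \<Rightarrow> nat \<Rightarrow> bool" where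
  "labelled cs p lo k a \<longleftrightarrow> p \<noteq> [] \<and> mset (concat cs @ p) = mset_set {lo..lo + int k} \<and>
     sum_list (map cycle_diffs cs) + path_diffs p = diff_target a k"

text \<open>Old differences stay and the target grows by \<open>k + 1, ..., k + N\<close>. So it
  suffices that the new cycles, the new stretch of the path and the edge leading to it have just
  these differences.\<close>

lemma labelled_extend:
  assumes "labelled cs p lo k a" "a = 0 \<or> 3 \<le> k" "ts \<noteq> []" "alternating ts"
    and verts: "mset (concat tcs @ ts) = mset_set {1..N}"
    and diffs: "sum_list (map (\<lambda>c. cycle_diffs (map (vertex lo k) c)) tcs) +
      image_mset (\<lambda>l. int (k + l)) (labels ts) + {#\<bar>last p - vertex lo k (hd ts)\<bar>#} =
      image_mset (\<lambda>l. int (k + l)) (mset_set {1..N})"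
  shows "labelled (map (map (vertex lo k)) tcs @ cs) (p @ map (vertex lo k) ts)
    (lo - int ((N + 1) div 2)) (k + N) a"
proof -
  have p: "p \<noteq> []" "mset (concat cs) + mset p = mset_set {lo..lo + int k}"
    "sum_list (map cycle_diffs cs) + path_diffs p = diff_target a k"
    using assms(1) by (auto simp: labelled_def)
  have "mset (concat (map (map (vertex lo k)) tcs @ cs) @ p @ map (vertex lo k) ts)
      = (mset (concat cs) + mset p) + image_mset (vertex lo k) (mset (concat tcs @ ts))"
    by (simp add: map_concat[symmetric])
  also have "\<dots> = mset_set {lo - int ((N + 1) div 2)..lo + int k + int (N div 2)}"
    unfolding p(2) verts by (rule vertex_interval)
  also have "lo + int k + int (N div 2) = lo - int ((N + 1) div 2) + int (k + N)"
    by (simp flip: of_nat_add add: add.commute)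
  finally have 1: "mset (concat (map (map (vertex lo k)) tcs @ cs) @ p @ map (vertex lo k) ts)
      = mset_set {lo - int ((N + 1) div 2)..lo - int ((N + 1) div 2) + int (k + N)}" .
  have "sum_list (map cycle_diffs (map (map (vertex lo k)) tcs @ cs)) + path_diffs (p @ map (vertex lo k) ts) =
     (sum_list (map cycle_diffs cs) + path_diffs p) +
     (sum_list (map (\<lambda>c. cycle_diffs (map (vertex lo k) c)) tcs) +
      image_mset (\<lambda>l. int (k + l)) (labels ts) + {#\<bar>last p - vertex lo k (hd ts)\<bar>#})"
    using p(1) assms(3,4)
    by (subst path_diffs_append) (auto simp: path_diffs_vertex hd_map comp_def)
  also have "\<dots> = diff_target a (k + N)"
    unfolding p(3) diffs by (rule diff_target_add[OF assms(2), symmetric])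
  finally show ?thesis using 1 p(1) by (simp add: labelled_def)
qed

text \<open>The depth is measured from the right end; \<open>b\<close> bounds the differences on
  cycles, so that the larger ones are left to the path.\<close>

definition depth_labelling :: "nat multiset \<Rightarrow> nat \<Rightarrow> nat \<Rightarrow> nat \<Rightarrow> nat \<Rightarrow> bool" where
  "depth_labelling S a k D b \<longleftrightarrow> (\<exists>cs p lo. labelled cs p lo k a \<and> mset (map length cs) = S \<and>
     last p = lo + int k - int D \<and> (\<forall>c\<in>set cs. c \<noteq> [] \<and> (\<forall>x\<in>#cycle_diffs c. x \<le> int b)))"

lemma mset_set_uminus: "image_mset uminus (mset_set {l..h::int}) = mset_set {- h..- l}"
  by (simp add: image_mset_mset_set)

text \<open>Negating all vertices exchanges the ends of the block and preserves absolute
  differences, so a depth measured from the left serves as well.\<close>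

lemma depth_labellingI:
  assumes "labelled cs p lo k a" "mset (map length cs) = S"
    and depth: "last p = lo + int k - int D \<or> last p = lo + int D"
    and cs: "\<forall>c\<in>set cs. c \<noteq> [] \<and> (\<forall>x\<in>#cycle_diffs c. x \<le> int b)"
  shows "depth_labelling S a k D b"
  using depth
proof
  assume "last p = lo + int k - int D"
  with assms show ?thesis unfolding depth_labelling_def by blast
next
  assume last: "last p = lo + int D"
  have p: "p \<noteq> []" "mset (concat cs @ p) = mset_set {lo..lo + int k}"
    "sum_list (map cycle_diffs cs) + path_diffs p = diff_target a k"
    using assms(1) by (auto simp: labelled_def)
  have "mset (concat (map (map uminus) cs) @ map uminus p) = image_mset uminus (mset (concat cs @ p))"
    by (simp add: map_concat[symmetric])
  also have "\<dots> = mset_set {- (lo + int k)..- (lo + int k) + int k}"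
    unfolding p(2) mset_set_uminus by simp
  finally have "mset (concat (map (map uminus) cs) @ map uminus p) =
      mset_set {- (lo + int k)..- (lo + int k) + int k}" .
  moreover have "map cycle_diffs (map (map uminus) cs) = map cycle_diffs cs"
    using cs by (auto simp: cycle_diffs_uminus)
  ultimately have "labelled (map (map uminus) cs) (map uminus p) (- (lo + int k)) k a"
    using p by (simp add: labelled_def path_diffs_uminus del: map_map)
  moreover have "mset (map length (map (map uminus) cs)) = S"
    using assms(2) by (simp add: comp_def)
  moreover have "last (map uminus p) = - (lo + int k) + int k - int D"
    using last p(1) by (simp add: last_map)
  moreover have "\<forall>c\<in>set (map (map uminus) cs). c \<noteq> [] \<and> (\<forall>x\<in>#cycle_diffs c. x \<le> int b)"
    using cs by (auto simp: cycle_diffs_uminus)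
  ultimately show ?thesis unfolding depth_labelling_def by blast
qed

lemma depth_labelling_mono:
  "depth_labelling S a k D b \<Longrightarrow> b \<le> b' \<Longrightarrow> depth_labelling S a k D b'"
  unfolding depth_labelling_def
  by (elim exE conjE, intro exI conjI, assumption+) (fastforce dest: bspec)

text \<open>Time \<open>2 * D + 1\<close> is the left vertex at distance \<open>k + 1\<close> from
  the end of the path, so the entry has label 1 and an alpha path supplies the labels
  \<open>2..N\<close>. It stops at time \<open>N - 2 * D\<close>, again at depth \<open>D\<close>,
  on the right or the left by the parity of \<open>N\<close>.\<close>

lemma depth_labelling_extend:
  assumes "depth_labelling S a k D b" "a = 0 \<or> 3 \<le> k"
    and N: "2 * D + 1 \<le> N" "even N \<or> N \<noteq> 4 * D + 1"
  shows "depth_labelling S a (k + N) D b"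
proof -
  obtain cs p lo where p: "labelled cs p lo k a" "mset (map length cs) = S"
    "last p = lo + int k - int D" "\<forall>c\<in>set cs. c \<noteq> [] \<and> (\<forall>x\<in>#cycle_diffs c. x \<le> int b)"
    using assms(1) by (auto simp: depth_labelling_def)
  have "\<exists>ts. alpha_path N (2 * D + 1) ts"
    using N by (intro alpha_path_exists) auto
  then obtain ts where "alpha_path N (2 * D + 1) ts" ..
  then have ts: "ts \<noteq> []" "mset ts = mset_set {1..N}" "alternating ts" "labels ts = mset_set {2..N}"
    "hd ts = 2 * D + 1" "last ts = N - 2 * D"
    by (auto simp: alpha_path_def)
  have "{1..N} = insert 1 {2..N}" using N by auto
  then have "image_mset (\<lambda>l. int (k + l)) (labels ts) + {#\<bar>last p - vertex lo k (hd ts)\<bar>#} =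
      image_mset (\<lambda>l. int (k + l)) (mset_set {1..N})"
    using ts p(3) by (simp add: vertex_def)
  then have "labelled (map (map (vertex lo k)) [] @ cs) (p @ map (vertex lo k) ts)
      (lo - int ((N + 1) div 2)) (k + N) a"
    using ts p(1) assms(2) by (intro labelled_extend) auto
  then have "labelled cs (p @ map (vertex lo k) ts) (lo - int ((N + 1) div 2)) (k + N) a" by simp
  then show ?thesis
  proof (rule depth_labellingI[OF _ p(2) _ p(4)])
    have "N \<ge> 2 * D" using N by simp
    have l: "last (p @ map (vertex lo k) ts) = vertex lo k (N - 2 * D)"
      using ts by (simp add: last_map)
    show "last (p @ map (vertex lo k) ts) = lo - int ((N + 1) div 2) + int (k + N) - int D \<or>
      last (p @ map (vertex lo k) ts) = lo - int ((N + 1) div 2) + int D"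
    proof (cases "even N")
      case True
      then obtain i where "N = 2 * i" by (rule evenE)
      then show ?thesis using N unfolding l by (simp add: vertex_def algebra_simps of_nat_diff flip: diff_mult_distrib2)
    next
      case False
      then obtain i where i: "N = 2 * i + 1" by (rule oddE)
      with N have "N - 2 * D = 2 * (i - D) + 1" "D \<le> i" by auto
      with i show ?thesis unfolding l by (simp add: vertex_def algebra_simps of_nat_diff)
    qed
  qed
qed

section \<open>Adding an odd cycle\<close>

lemma depth_labelling_add_cycle:
  assumes "depth_labelling S a k D b" "a = 0 \<or> 3 \<le> k" "1 \<le> r"
    and k: "2 * D + 3 * r \<le> k" "k \<noteq> 4 * D + 5 * r" and b: "b \<le> 2 * k + r + 2"
  shows "depth_labelling (add_mset (2 * r + 1) S) a (5 * k + 2 * D + 5) (k + D + 1) (2 * k + r + 2)"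
proof -
  obtain cs p lo where p: "labelled cs p lo k a" "mset (map length cs) = S"
    "last p = lo + int k - int D" "\<forall>c\<in>set cs. c \<noteq> [] \<and> (\<forall>x\<in>#cycle_diffs c. x \<le> int b)"
    using assms(1) by (auto simp: depth_labelling_def)
  \<comment> \<open>Relative to time \<open>2 * r\<close>, the path enters at
    \<open>2 * i - 1\<close>, and the cycle occupies time \<open>2 * v - 1\<close> and label
    \<open>v\<close>.\<close>
  define i where "i = D + r + 1"
  define v where "v = k + 2 - r"
  have iv: "2 \<le> i" "2 * i \<le> v" "v \<noteq> 4 * i - 2" "v + r = k + 2"
    using k assms(3) by (auto simp: i_def v_def)
  \<comment> \<open>The middle piece must begin at \<open>v + 2 * i - 3\<close> and end at
    \<open>v\<close>; \<open>N\<close> gives it the length \<open>2 * v + 2 * i - 4\<close> that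
    matches these ends. This is even, so any start is allowed.\<close>
  define N where "N = 4 * v + 2 * i - 5"
  have N: "N + 5 = 4 * v + 2 * i" "2 * r + N = 4 * k + 2 * D + 5"
    using iv k by (auto simp: N_def i_def)
  \<comment> \<open>The start is odd, and \<open>k \<noteq> 4 * D + 5 * r\<close> says that it is
    not the midpoint of \<open>1..v - 1\<close>.\<close>
  have "\<exists>ts. alpha_path (v - 1) (2 * i - 1) ts"
    using iv by (intro alpha_path_exists) auto
  then obtain ts1 where ts1: "alpha_path (v - 1) (2 * i - 1) ts1" ..
  have "\<exists>ts. alpha_path (2 * v + 2 * i - 4) (v + 2 * i - 3) ts"
    using iv by (intro alpha_path_exists) auto
  then obtain ts2 where ts2: "alpha_path (2 * v + 2 * i - 4) (v + 2 * i - 3) ts2" ..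
  text \<open>
    Relative to the \<open>2r\<close> times used by the cycle, \<open>us\<close> must avoid the time \<open>2v - 1\<close> and the label \<open>v\<close>.
    The labels \<open>2v - 1\<close> and \<open>2v\<close> freed by that time serve for the two jumps between the three pieces.
  \<close>
  define us where "us = ts1 @ map ((+) (2 * v - 1)) ts2 @ [v..<2 * v - 1]"
  have ts1': "ts1 \<noteq> []" "mset ts1 = mset_set {1..v - 1}" "alternating ts1" "labels ts1 = mset_set {2..v - 1}"
    "hd ts1 = 2 * i - 1" "last ts1 = v + 1 - 2 * i"
    using ts1 iv by (auto simp: alpha_path_def)
  have ts2': "map ((+) (2 * v - 1)) ts2 \<noteq> []" "mset (map ((+) (2 * v - 1)) ts2) = mset_set {2 * v..N}"
    "alternating (map ((+) (2 * v - 1)) ts2)"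
    "labels (map ((+) (2 * v - 1)) ts2) = mset_set {2 * v + 1..N}"
    "hd (map ((+) (2 * v - 1)) ts2) = 3 * v + 2 * i - 4" "last (map ((+) (2 * v - 1)) ts2) = 3 * v - 1"
    using ts2 iv N
    by (auto simp: alpha_path_def mset_set_shift labels_map_add alternating_map_add hd_map last_map
        intro!: arg_cong[of _ _ mset_set])
  have j1: "last ts1 + hd (map ((+) (2 * v - 1)) ts2) + 1 = 2 * (2 * v - 1)"
    and j2: "last (map ((+) (2 * v - 1)) ts2) + v + 1 = 2 * (2 * v)"
    unfolding ts1' ts2' using iv by auto
  have ts3: "[v..<2 * v - 1] \<noteq> []" "hd [v..<2 * v - 1] = v" "last [v..<2 * v - 1] = 2 * v - 2"
    using iv by auto
  have us: "us \<noteq> []" "hd us = 2 * i - 1" "last us = 2 * v - 2"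
    using ts1' ts3 by (auto simp: us_def)
  have "odd (last ts1 + hd (map ((+) (2 * v - 1)) ts2))" "odd (last (map ((+) (2 * v - 1)) ts2) + v)"
    using j1 j2 by (metis add.commute even_Suc even_mult_iff even_numeral plus_1_eq_Suc)+
  then have us_alt: "alternating us"
    unfolding us_def using ts1' ts2' ts3 by (simp add: alternating_append alternating_upt)
  have us_labels: "labels us = {#2 * v - 1, 2 * v#} + mset_set {2..v - 1} + mset_set {2 * v + 1..N} + mset_set {v<..<2 * v - 1}"
    unfolding us_def using ts1' ts2' ts3 j1 j2 by (simp add: labels_append labels_upt)
  have us_mset: "mset us = mset_set {1..v - 1} + mset_set {2 * v..N} + mset_set {v..<2 * v - 1}"
    unfolding us_def using ts1' ts2' by simp
  \<comment> \<open>An odd cycle cannot alternate. Times \<open>2 * k + 3\<close> and 1 are both on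
    the left, at distance \<open>k + 1\<close>, so their edge takes the difference belonging to
    label 1.\<close>
  define zs where "zs = [1..<2 * r + 1] @ [2 * k + 3]"
  have z: "[1..<2 * r + 1] \<noteq> []" "last [1..<2 * r + 1] = 2 * r" "hd [1..<2 * r + 1] = 1"
    using assms(3) by auto
  have zs_alt: "alternating zs" and zs_labels: "labels zs = add_mset (k + r + 2) (mset_set {1<..<2 * r + 1})"
    unfolding zs_def using z by (simp_all add: alternating_append alternating_upt labels_append labels_upt del: upt_Suc)
  define V where "V = vertex lo k"
  have "cycle_diffs (map V zs) = path_diffs (map V zs @ [V 1])"
    unfolding cycle_diffs_def using z by (simp add: zs_def hd_map del: upt_Suc)
  also have "\<dots> = add_mset (int (k + 1)) (path_diffs (map V zs))"
    by (subst path_diffs_append) (simp_all add: zs_def V_def vertex_def del: upt_Suc)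
  also have "\<dots> = image_mset (\<lambda>l. int (k + l)) (add_mset 1 (labels zs))"
    unfolding V_def path_diffs_vertex[OF zs_alt] by simp
  finally have cyc: "cycle_diffs (map V zs) = image_mset (\<lambda>l. int (k + l)) (add_mset 1 (labels zs))" .
  have last: "\<bar>last p - V (hd (map ((+) (2 * r)) us))\<bar> = int (k + (2 * r + 1))"
    using us p(3) iv by (simp add: V_def vertex_def i_def hd_map)
  have "labelled (map (map V) [zs] @ cs) (p @ map V (map ((+) (2 * r)) us))
      (lo - int ((2 * r + N + 1) div 2)) (k + (2 * r + N)) a"
    unfolding V_def
  proof (rule labelled_extend[OF p(1) assms(2)])
    \<comment> \<open>The times in order: run of the cycle, first piece, last piece, lone vertex of
      the cycle, middle piece.\<close>
    have "mset_set {1..2 * r + N} = mset_set {1..<2 * r + 1} + (mset_set {2 * r + 1..<2 * r + v} +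
        (mset_set {2 * r + v..<2 * k + 3} + (mset_set {2 * k + 3..<2 * k + 4} + mset_set {2 * k + 4..<2 * r + N + 1})))"
      using iv N by (simp flip: mset_set_split atLeastLessThanSuc_atLeastAtMost)
    moreover have "{2 * r + 1..<2 * r + v} = {2 * r + 1..2 * r + (v - 1)}"
      "{2 * r + v..<2 * k + 3} = {2 * r + v..<2 * r + (2 * v - 1)}"
      "{2 * k + 3..<2 * k + 4} = {2 * k + 3}" "{2 * k + 4..<2 * r + N + 1} = {2 * r + 2 * v..2 * r + N}"
      using iv by auto
    ultimately show "mset (concat [zs] @ map ((+) (2 * r)) us) = mset_set {1..2 * r + N}"
      by (simp add: zs_def us_mset mset_set_shift del: upt_Suc)
    \<comment> \<open>The labels in order: closing edge, run of the cycle, entry of the path, first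
      piece, edge from the run to the lone vertex, last piece, the two jumps, middle piece.\<close>
    have "mset_set {1..2 * r + N} = mset_set {1..<2} + (mset_set {2..<2 * r + 1} + (mset_set {2 * r + 1..<2 * r + 2} +
        (mset_set {2 * r + 2..<2 * r + v} + (mset_set {2 * r + v..<2 * r + v + 1} +
        (mset_set {2 * r + v + 1..<2 * r + 2 * v - 1} + (mset_set {2 * r + 2 * v - 1..<2 * r + 2 * v} +
        (mset_set {2 * r + 2 * v..<2 * r + 2 * v + 1} + mset_set {2 * r + 2 * v + 1..<2 * r + N + 1})))))))"
    proof -
      have "2 * r + 2 * v + 1 \<le> 2 * r + N + 1" "2 * r + 1 \<le> 2 * r + N + 1" "2 \<le> 2 * r + 1" "2 * r + v \<le> 2 * r + N + 1"
        "2 * r + 2 \<le> 2 * r + v" "2 * r + v + 1 \<le> 2 * r + 2 * v - 1"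
        using iv N assms(3) by linarith+
      then have "mset_set {1..<2 * r + N + 1} = mset_set {1..<2} + mset_set {2..<2 * r + N + 1}"
        "mset_set {2..<2 * r + N + 1} = mset_set {2..<2 * r + 1} + mset_set {2 * r + 1..<2 * r + N + 1}"
        "mset_set {2 * r + 1..<2 * r + N + 1} = mset_set {2 * r + 1..<2 * r + 2} + mset_set {2 * r + 2..<2 * r + N + 1}"
        "mset_set {2 * r + 2..<2 * r + N + 1} = mset_set {2 * r + 2..<2 * r + v} + mset_set {2 * r + v..<2 * r + N + 1}"
        "mset_set {2 * r + v..<2 * r + N + 1} = mset_set {2 * r + v..<2 * r + v + 1} + mset_set {2 * r + v + 1..<2 * r + N + 1}"
        "mset_set {2 * r + v + 1..<2 * r + N + 1} =
          mset_set {2 * r + v + 1..<2 * r + 2 * v - 1} + mset_set {2 * r + 2 * v - 1..<2 * r + N + 1}"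
        "mset_set {2 * r + 2 * v - 1..<2 * r + N + 1} =
          mset_set {2 * r + 2 * v - 1..<2 * r + 2 * v} + mset_set {2 * r + 2 * v..<2 * r + N + 1}"
        "mset_set {2 * r + 2 * v..<2 * r + N + 1} =
          mset_set {2 * r + 2 * v..<2 * r + 2 * v + 1} + mset_set {2 * r + 2 * v + 1..<2 * r + N + 1}"
        by (intro mset_set_split; linarith)+
      moreover have "{1..2 * r + N} = {1..<2 * r + N + 1}" by auto
      ultimately show ?thesis by (simp only:)
    qed
    moreover have "{1..<2} = {1::nat}" "{2..<2 * r + 1} = {1<..<2 * r + 1}" "{2 * r + 1..<2 * r + 2} = {2 * r + 1}"
      "{2 * r + 2..<2 * r + v} = {2 * r + 2..2 * r + (v - 1)}" "{2 * r + v..<2 * r + v + 1} = {k + r + 2}"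
      "{2 * r + v + 1..<2 * r + 2 * v - 1} = {2 * r + v<..<2 * r + (2 * v - 1)}"
      "{2 * r + 2 * v - 1..<2 * r + 2 * v} = {2 * r + (2 * v - 1)}" "{2 * r + 2 * v..<2 * r + 2 * v + 1} = {2 * r + 2 * v}"
      "{2 * r + 2 * v + 1..<2 * r + N + 1} = {2 * r + (2 * v + 1)..2 * r + N}"
      using iv by auto
    ultimately have all: "mset_set {1..2 * r + N} = add_mset 1 (labels zs) + labels (map ((+) (2 * r)) us) + {#2 * r + 1#}"
      by (simp add: zs_labels labels_map_add us_labels mset_set_shift)
    show "sum_list (map (\<lambda>c. cycle_diffs (map (vertex lo k) c)) [zs]) +
        image_mset (\<lambda>l. int (k + l)) (labels (map ((+) (2 * r)) us)) +
        {#\<bar>last p - vertex lo k (hd (map ((+) (2 * r)) us))\<bar>#} =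
        image_mset (\<lambda>l. int (k + l)) (mset_set {1..2 * r + N})"
      unfolding all using cyc last by (simp add: V_def)
  qed (use us us_alt in \<open>auto simp: alternating_map_add\<close>)
  moreover have "k + (2 * r + N) = 5 * k + 2 * D + 5" using N by simp
  ultimately have "labelled (map V zs # cs) (p @ map V (map ((+) (2 * r)) us))
      (lo - int ((2 * r + N + 1) div 2)) (5 * k + 2 * D + 5) a" by simp
  then show ?thesis
  proof (rule depth_labellingI)
    show "mset (map length (map V zs # cs)) = add_mset (2 * r + 1) S"
      using p(2) by (simp add: zs_def)
    \<comment> \<open>The path stops at time \<open>2 * (k + 1)\<close>, which is
      \<open>k + 1\<close> places right of the old block, while the new block reaches
      \<open>2 * k + D + 2\<close> places to the right.\<close>
    have "2 * r + (2 * v - 2) = 2 * (r + v - 1)" using iv by auto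
    then have "last (p @ map V (map ((+) (2 * r)) us)) = V (2 * (r + v - 1))"
      using us by (simp add: last_map)
    then show "last (p @ map V (map ((+) (2 * r)) us)) =
        lo - int ((2 * r + N + 1) div 2) + int (5 * k + 2 * D + 5) - int (k + D + 1) \<or>
      last (p @ map V (map ((+) (2 * r)) us)) = lo - int ((2 * r + N + 1) div 2) + int (k + D + 1)"
      using N iv by (simp add: V_def vertex_def)
    show "\<forall>c\<in>set (map V zs # cs). c \<noteq> [] \<and> (\<forall>x\<in>#cycle_diffs c. x \<le> int (2 * k + r + 2))"
    proof (intro ballI conjI)
      fix c x assume c: "c \<in> set (map V zs # cs)"
      then show "c \<noteq> []" using p(4) by (auto simp: zs_def)
      assume x: "x \<in># cycle_diffs c"
      show "x \<le> int (2 * k + r + 2)"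
      proof (cases "c \<in> set cs")
        case True
        then have "x \<le> int b" using p(4) x by blast
        then show ?thesis using b by linarith
      next
        case False
        with c have "c = map V zs" by simp
        then show ?thesis using x k assms(3) by (auto simp: cyc zs_labels)
      qed
    qed
  qed
qed

section \<open>The first cycle\<close>

lemma labelled_single: "labelled [] [0] 0 0 0"
  by (simp add: labelled_def diff_target_def)

text \<open>Around the block \<open>{0}\<close> the cycle takes the times up to
  \<open>2 * r + 2\<close> except \<open>r + 2\<close>. The skip joins two vertices on one side and
  gives the difference 1. The cycle misses the label \<open>r + 3\<close>, with which the path
  leaves 0; the path runs through all later times and ends at \<open>r + 2\<close>.\<close>

lemma single_odd_cycle:
  assumes "1 \<le> r"
  shows "depth_labelling {#2 * r + 1#} 0 (if odd r then 3 * r + 5 else 3 * r + 6)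
    (if odd r then r + 1 else r + 2) (2 * r + 2)"
proof -
  \<comment> \<open>Times \<open>2 * r + 5\<close> and \<open>2 * r + 6\<close> both lie at distance
    \<open>r + 3\<close> from 0; the choice makes \<open>r + s\<close> even, so that the alpha path
    exists.\<close>
  define s :: nat where "s = (if odd r then 3 else 4)"
  define N where "N = 3 * r + 2 + s"
  have "\<exists>ts. alpha_path (r + s) s ts"
    using assms by (intro alpha_path_exists) (auto simp: s_def)
  then obtain ts where "alpha_path (r + s) s ts" ..
  then have ts: "ts \<noteq> []" "mset ts = mset_set {1..r + s}" "alternating ts" "labels ts = mset_set {2..r + s}"
    "hd ts = s" "last ts = r + 1"
    by (auto simp: alpha_path_def)
  define us where "us = map ((+) (2 * r + 2)) ts @ [r + 2]"
  have us: "us \<noteq> []" "hd us = 2 * r + 2 + s" "last us = r + 2"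
    using ts by (auto simp: us_def hd_map)
  have l: "last (map ((+) (2 * r + 2)) ts) = 3 * r + 3" using ts by (simp add: last_map)
  have us_alt: "alternating us" and us_labels: "labels us = add_mset (2 * r + 3) (mset_set {2 * r + 4..N})"
    unfolding us_def using ts l
    by (simp_all add: alternating_append alternating_map_add labels_append labels_map_add mset_set_shift
      N_def add_ac)
  define V where "V = vertex 0 0"
  define zs where "zs = [1..<r + 2] @ [r + 3..<2 * r + 3]"
  have z: "[1..<r + 2] \<noteq> []" "last [1..<r + 2] = r + 1" "hd [1..<r + 2] = 1"
    "[r + 3..<2 * r + 3] \<noteq> []" "last [r + 3..<2 * r + 3] = 2 * r + 2" "hd [r + 3..<2 * r + 3] = r + 3"
    using assms by (simp_all del: upt_Suc)
  have j: "\<bar>V (r + 1) - V (r + 3)\<bar> = 1"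
  proof (cases "odd r")
    case True
    then obtain q where "r = 2 * q + 1" by (rule oddE)
    then show ?thesis by (simp add: V_def vertex_def)
  next
    case False
    then obtain q where "r = 2 * q" by (auto elim: evenE)
    then show ?thesis by (simp add: V_def vertex_def)
  qed
  have c: "\<bar>V (2 * r + 2) - V 1\<bar> = int (r + 2)" by (simp add: V_def vertex_def)
  have "cycle_diffs (map V zs) = path_diffs ((map V [1..<r + 2] @ map V [r + 3..<2 * r + 3]) @ [V 1])"
    unfolding cycle_diffs_def zs_def using z by (simp add: hd_map del: upt_Suc)
  also have "\<dots> = {#int (r + 2), 1#} + image_mset int (mset_set {1<..<r + 2} + mset_set {r + 3<..<2 * r + 3})"
    using z j c path_diffs_vertex[of "[1..<r + 2]" 0 0] path_diffs_vertex[of "[r + 3..<2 * r + 3]" 0 0]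
    by (simp add: path_diffs_append last_map hd_map alternating_upt labels_upt V_def del: upt_Suc)
  finally have cyc: "cycle_diffs (map V zs) =
    image_mset int (add_mset (r + 2) (add_mset 1 (mset_set {1<..<r + 2} + mset_set {r + 3<..<2 * r + 3})))"
    by simp
  have first: "\<bar>0 - V (hd us)\<bar> = int (r + 3)"
    using us by (cases "odd r") (auto simp: V_def vertex_def s_def)
  have "labelled (map (map V) [zs] @ []) ([0] @ map V us) (0 - int ((N + 1) div 2)) (0 + N) 0"
    unfolding V_def
  proof (rule labelled_extend[OF labelled_single])
    have "mset_set {1..N} = mset_set {1..<r + 2} + (mset_set {r + 2..<r + 3} + (mset_set {r + 3..<2 * r + 3} +
        mset_set {2 * r + 3..<N + 1}))"
      by (simp add: N_def flip: mset_set_split atLeastLessThanSuc_atLeastAtMost)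
    moreover have "{2 * r + 3..<N + 1} = {2 * r + 3..N}" "{r + 2..<r + 3} = {r + 2}" by auto
    ultimately show "mset (concat [zs] @ us) = mset_set {1..N}"
      using ts by (simp add: zs_def us_def mset_set_shift N_def add_ac del: upt_Suc)
    have "mset_set {1..<N + 1} = mset_set {1..<2} + mset_set {2..<N + 1}"
      "mset_set {2..<N + 1} = mset_set {2..<r + 2} + mset_set {r + 2..<N + 1}"
      "mset_set {r + 2..<N + 1} = mset_set {r + 2..<r + 3} + mset_set {r + 3..<N + 1}"
      "mset_set {r + 3..<N + 1} = mset_set {r + 3..<r + 4} + mset_set {r + 4..<N + 1}"
      "mset_set {r + 4..<N + 1} = mset_set {r + 4..<2 * r + 3} + mset_set {2 * r + 3..<N + 1}"
      "mset_set {2 * r + 3..<N + 1} = mset_set {2 * r + 3..<2 * r + 4} + mset_set {2 * r + 4..<N + 1}"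
      using assms by (intro mset_set_split; simp add: N_def s_def)+
    moreover have "{1..N} = {1..<N + 1}" "{1..<2} = {1::nat}" "{2..<r + 2} = {1<..<r + 2}"
      "{r + 2..<r + 3} = {r + 2}" "{r + 3..<r + 4} = {r + 3}" "{r + 4..<2 * r + 3} = {r + 3<..<2 * r + 3}"
      "{2 * r + 3..<2 * r + 4} = {2 * r + 3}" "{2 * r + 4..<N + 1} = {2 * r + 4..N}"
      by auto
    ultimately have "mset_set {1..N} =
        add_mset (r + 2) (add_mset 1 (mset_set {1<..<r + 2} + mset_set {r + 3<..<2 * r + 3})) + labels us + {#r + 3#}"
      unfolding us_labels by simp
    then show "sum_list (map (\<lambda>c. cycle_diffs (map (vertex 0 0) c)) [zs]) +
        image_mset (\<lambda>l. int (0 + l)) (labels us) + {#\<bar>last [0] - vertex 0 0 (hd us)\<bar>#} =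
        image_mset (\<lambda>l. int (0 + l)) (mset_set {1..N})"
      using cyc first by (simp add: V_def)
  qed (use us us_alt in auto)
  then have "labelled [map V zs] ([0] @ map V us) (- int ((N + 1) div 2)) N 0" by simp
  then have "depth_labelling {#2 * r + 1#} 0 N (if odd r then r + 1 else r + 2) (2 * r + 2)"
  proof (rule depth_labellingI)
    show "last ([0] @ map V us) = - int ((N + 1) div 2) + int N - int (if odd r then r + 1 else r + 2) \<or>
      last ([0] @ map V us) = - int ((N + 1) div 2) + int (if odd r then r + 1 else r + 2)"
    proof (cases "odd r")
      case True
      then obtain q where "r = 2 * q + 1" by (rule oddE)
      moreover have "(9 + 6 * q) div 2 = 4 + 3 * q" by simp
      ultimately show ?thesis using us by (simp add: last_map V_def vertex_def N_def s_def)
    next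
      case False
      then obtain q where "r = 2 * q" by (auto elim: evenE)
      moreover have "(7 + 6 * q) div 2 = 3 + 3 * q" by simp
      ultimately show ?thesis using us by (simp add: last_map V_def vertex_def N_def s_def)
    qed
    have "zs \<noteq> []" "\<forall>x\<in>#cycle_diffs (map V zs). x \<le> int (2 * r + 2)"
      unfolding cyc using z(1) assms by (auto simp: zs_def)
    then show "\<forall>c\<in>set [map V zs]. c \<noteq> [] \<and> (\<forall>x\<in>#cycle_diffs c. x \<le> int (2 * r + 2))"
      by simp
    show "mset (map length [map V zs]) = {#2 * r + 1#}"
      using assms by (simp add: zs_def del: upt_Suc)
  qed
  moreover have "N = (if odd r then 3 * r + 5 else 3 * r + 6)" by (simp add: N_def s_def)
  ultimately show ?thesis by simp
qed

lemma mset_set_upto: "mset_set {i..j} = mset [i..j]"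
  using mset_set_set[of "[i..j]"] by simp

text \<open>
  For the two shortest cycles \<open>single_odd_cycle\<close> leaves the end of the path too deep for a second cycle.
\<close>

lemma triangle: "depth_labelling {#3#} 0 13 1 3"
  by (rule depth_labellingI[where cs = "[[-1, 1, -2]]" and lo = "-7" and
        p = "[0, -4, 4, -5, 2, -3, 3, -7, 6, -6, 5]"])
    (simp_all add: labelled_def diff_target_def cycle_diffs_def mset_set_upto upto.simps)

lemma pentagon: "depth_labelling {#5#} 0 6 2 6"
  by (rule depth_labellingI[where cs = "[[-1, -3, 3, -2, 2]]" and lo = "-3" and p = "[0, 1]"])
    (simp_all add: labelled_def diff_target_def cycle_diffs_def mset_set_upto upto.simps)

lemma no_cycle: "depth_labelling {#} 0 0 0 0"
  by (rule depth_labellingI[OF labelled_single]) simp_all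

text \<open>The cycle on 0 and 3 uses the difference 3 twice and the path from 1 to 2 supplies 1,
  whence \<open>{#1, 3, 3#}\<close>.\<close>

lemma two_cycle: "depth_labelling {#2#} 1 3 1 3"
  by (rule depth_labellingI[where cs = "[[0, 3]]" and lo = 0 and p = "[1, 2]"])
    (simp_all add: labelled_def diff_target_def cycle_diffs_def mset_set_upto upto.simps)

section \<open>Iteration\<close>

text \<open>
  \<open>expandable M S a B\<close> is the invariant under which a further cycle of length at most \<open>2M+1\<close> can be
  added, and \<open>completable S a B\<close> the one under which \<open>\<epsilon>\<^sub>1 = B/3\<close> works for \<open>S\<close>.  Adding a cycle
  multiplies \<open>B\<close> by 7 and turns \<open>k + 4D + 2\<close> into \<open>9k + 6D + 11\<close>.
\<close>

definition expandable :: "nat \<Rightarrow> nat multiset \<Rightarrow> nat \<Rightarrow> nat \<Rightarrow> bool" where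
  "expandable M S a B \<longleftrightarrow> (\<forall>r\<in>{1..M}. \<exists>k D. depth_labelling S a k D k \<and> (a = 0 \<or> 3 \<le> k) \<and>
     2 * D + 5 * M \<le> k \<and> k \<noteq> 4 * D + 5 * r \<and> 9 * k + 6 * D + 11 \<le> 7 * B)"

definition completable :: "nat multiset \<Rightarrow> nat \<Rightarrow> nat \<Rightarrow> bool" where
  "completable S a B \<longleftrightarrow> (\<exists>k D b. depth_labelling S a k D b \<and> (a = 0 \<or> 3 \<le> k) \<and>
     3 * b \<le> B \<and> k + 4 * D + 2 \<le> B)"

lemma expandable_add_cycle:
  assumes "expandable M S a B" "1 \<le> r" "r \<le> M"
  shows "completable (add_mset (2 * r + 1) S) a (7 * B) \<and> expandable M (add_mset (2 * r + 1) S) a (7 * B)"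
proof -
  obtain k D where k: "depth_labelling S a k D k" "a = 0 \<or> 3 \<le> k" "2 * D + 5 * M \<le> k"
    "k \<noteq> 4 * D + 5 * r" "9 * k + 6 * D + 11 \<le> 7 * B"
    using assms unfolding expandable_def by (meson atLeastAtMost_iff)
  have new: "depth_labelling (add_mset (2 * r + 1) S) a (5 * k + 2 * D + 5) (k + D + 1) (2 * k + r + 2)"
    using k(2-) assms(2,3) by (intro depth_labelling_add_cycle[OF k(1)]) auto
  have "completable (add_mset (2 * r + 1) S) a (7 * B)"
    unfolding completable_def by (intro exI conjI, rule new) (use k(2-) assms(2,3) in auto)
  \<comment> \<open>One pair serves every next cycle: for \<open>k' = 5 * k + 2 * D + 5\<close> and
    \<open>D' = k + D + 1\<close>, the bound \<open>2 * D + 5 * M \<le> k\<close> gives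
    \<open>4 * D' + 5 * r' < k'\<close> for all \<open>r' \<le> M\<close>.\<close>
  moreover have "expandable M (add_mset (2 * r + 1) S) a (7 * B)"
    unfolding expandable_def
    by (intro ballI exI conjI, rule depth_labelling_mono[OF new]) (use k(2-) assms(2,3) in auto)
  ultimately show ?thesis ..
qed

lemma expandable_add_cycles:
  assumes "expandable M S a B" "\<forall>l\<in>#L. odd l \<and> 1 < l \<and> l \<le> 2 * M + 1"
  shows "expandable M (L + S) a (7 ^ size L * B) \<and> (L \<noteq> {#} \<longrightarrow> completable (L + S) a (7 ^ size L * B))"
  using assms(2)
proof (induction L)
  case (add l L)
  then obtain r where "l = 2 * r + 1" by (auto elim: oddE)
  with add assms(1) show ?case
    using expandable_add_cycle[of M "L + S" a "7 ^ size L * B" r] by (simp add: mult.assoc)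
qed (use assms in simp)

text \<open>For the length \<open>l = 2 * M + 1\<close> the factor \<open>4 * M + 3\<close> is
  \<open>2 * l + 1\<close>. Depth 1 forbids only block lengths congruent to 4 modulo 5.\<close>

lemma expandable_two_cycle:
  assumes "1 \<le> M"
  shows "expandable M {#2#} 1 (3 * (4 * M + 3))"
proof -
  have "depth_labelling {#2#} 1 (3 + (5 * M + 2)) 1 3"
    by (rule depth_labelling_extend[OF two_cycle]) (use assms in auto)
  then have "depth_labelling {#2#} 1 (5 * M + 5) 1 3" by (simp add: add.commute)
  then have "depth_labelling {#2#} 1 (5 * M + 5) 1 (5 * M + 5)" by (rule depth_labelling_mono) simp
  moreover have "5 * M + 5 \<noteq> 4 * 1 + 5 * r" for r by presburger
  moreover have "9 * (5 * M + 5) + 6 * 1 + 11 \<le> 7 * (3 * (4 * M + 3))" using assms by simp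
  ultimately show ?thesis
    unfolding expandable_def by (intro ballI exI[of _ "5 * M + 5"] exI[of _ 1]) simp
qed

lemma completable_single_odd_cycle:
  assumes "1 \<le> M"
  shows "completable {#2 * M + 1#} 0 (3 * (4 * M + 3))"
  unfolding completable_def
  by (intro exI conjI, rule single_odd_cycle[OF assms]) (use assms in auto)

lemma expandable_single_odd_cycle:
  assumes "1 \<le> M"
  shows "expandable M {#2 * M + 1#} 0 (3 * (4 * M + 3))"
proof -
  consider "M = 1" | "M = 2" | "3 \<le> M" using assms by linarith
  then show ?thesis
  proof cases
    case 1
    have "depth_labelling {#3#} 0 13 1 13" by (rule depth_labelling_mono[OF triangle]) simp
    then show ?thesis
      unfolding expandable_def 1 by (intro ballI exI[of _ 13] exI[of _ 1]) simp
  next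
    case 2
    have "depth_labelling {#5#} 0 (6 + 8) 2 6" by (rule depth_labelling_extend[OF pentagon]) simp_all
    then have "depth_labelling {#5#} 0 14 2 14" by (intro depth_labelling_mono[where b = 6 and b' = 14]) simp_all
    moreover have "14 \<noteq> 4 * 2 + 5 * r" for r :: nat by presburger
    ultimately show ?thesis
      unfolding expandable_def 2 by (intro ballI exI[of _ 14] exI[of _ 2]) simp
  next
    case 3
    define K where "K = (if odd M then 3 * M + 5 else 3 * M + 6)"
    define D where "D = (if odd M then M + 1 else M + 2)"
    have base: "depth_labelling {#2 * M + 1#} 0 K D (2 * M + 2)"
      using single_odd_cycle[OF assms] by (simp add: K_def D_def)
    show ?thesis
      unfolding expandable_def
    proof (intro ballI)
      fix r
      \<comment> \<open>\<open>7 * M + 4\<close> is \<open>2 * D + 5 * M\<close> for the largest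
        depth \<open>D = M + 2\<close>; one of two consecutive values avoids the forbidden
        one.\<close>
      define k where "k = (if 4 * D + 5 * r = 7 * M + 4 then 7 * M + 5 else 7 * M + 4)"
      have k: "7 * M + 4 \<le> k" "k \<le> 7 * M + 5" "k \<noteq> 4 * D + 5 * r" by (auto simp: k_def)
      have D: "D \<le> M + 2" by (simp add: D_def)
      have "4 \<le> M" if "even M" using 3 that by (cases "M = 3") auto
      \<comment> \<open>The extension from \<open>K\<close> to \<open>k\<close> is long enough, yet
        shorter than the exceptional length \<open>4 * D + 1\<close>.\<close>
      then have KD: "2 * D + 1 + K \<le> 7 * M + 4" "K + 4 * D + 1 > 7 * M + 5"
        using 3 by (auto simp: K_def D_def)
      have "depth_labelling {#2 * M + 1#} 0 (K + (k - K)) D (2 * M + 2)"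
        by (rule depth_labelling_extend[OF base]) (use k(1,2) KD in linarith)+
      moreover have "K + (k - K) = k" using k(1) KD(1) by linarith
      ultimately have "depth_labelling {#2 * M + 1#} 0 k D (2 * M + 2)" by simp
      then have "depth_labelling {#2 * M + 1#} 0 k D k"
        by (rule depth_labelling_mono) (use k(1) in linarith)
      moreover have "2 * D + 5 * M \<le> k" "9 * k + 6 * D + 11 \<le> 84 * M + 63"
        using k(1,2) D 3 by linarith+
      ultimately show "\<exists>k D. depth_labelling {#2 * M + 1#} 0 k D k \<and> (0 = 0 \<or> 3 \<le> k) \<and>
          2 * D + 5 * M \<le> k \<and> k \<noteq> 4 * D + 5 * r \<and> 9 * k + 6 * D + 11 \<le> 7 * (3 * (4 * M + 3))"
        using k(3) by (intro exI[of _ k] exI[of _ D]) simp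
    qed
  qed
qed

lemma depth_labelling_exists:
  fixes L :: "nat multiset"
  assumes L: "\<forall>l\<in>#L. odd l \<and> l > 1" and a: "a \<in> {0, 1}"
    and e1: "e1 = (if L = {#} then 3 else 7 ^ (size L + a - 1) * (2 * Max (set_mset L) + 1))"
    and e: "3 * e1 \<le> e"
  shows "\<exists>D. depth_labelling (L + replicate_mset a 2) a e D e1"
proof -
  have "completable (L + replicate_mset a 2) a (3 * e1)"
  proof (cases "L = {#}")
    case True
    have "completable {#} 0 9" unfolding completable_def
      by (intro exI conjI, rule no_cycle) auto
    \<comment> \<open>Both bounds are attained here: \<open>3 * b = 9\<close> and
      \<open>k + 4 * D + 2 = 9\<close>.\<close>
    moreover have "completable {#2#} 1 9" unfolding completable_def
      by (intro exI conjI, rule two_cycle) auto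
    ultimately show ?thesis using a True e1 by auto
  next
    case False
    define l where "l = Max (set_mset L)"
    have l: "l \<in># L" "\<forall>l'\<in>#L. l' \<le> l" using False by (auto simp: l_def)
    with L obtain M where M: "l = 2 * M + 1" by (meson oddE)
    then have "1 \<le> M" using l L by fastforce
    have e1': "e1 = 7 ^ (size L + a - 1) * (2 * (2 * M + 1) + 1)"
      using e1 False M by (simp add: l_def)
    have L': "\<forall>l\<in>#L. odd l \<and> 1 < l \<and> l \<le> 2 * M + 1" using L l M by auto
    show ?thesis
    proof (cases "a = 0")
      case True
      \<comment> \<open>Without a 2-cycle a longest odd cycle starts the construction, so one factor
        7 fewer arises.\<close>
      obtain L0 where L0: "L = add_mset l L0" using l(1) by (meson multi_member_split)
      have "completable (L0 + {#2 * M + 1#}) 0 (7 ^ size L0 * (3 * (4 * M + 3)))"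
        using expandable_add_cycles[OF expandable_single_odd_cycle[OF \<open>1 \<le> M\<close>], of L0] L' L0
          completable_single_odd_cycle[OF \<open>1 \<le> M\<close>] by (cases "L0 = {#}") auto
      moreover have "3 * e1 = 7 ^ size L0 * (3 * (4 * M + 3))"
        unfolding e1' True L0 by (simp add: algebra_simps)
      ultimately show ?thesis using True L0 M by simp
    next
      case False
      then have "a = 1" using a by auto
      moreover have "3 * e1 = 7 ^ size L * (3 * (4 * M + 3))"
        unfolding e1' \<open>a = 1\<close> by (simp add: algebra_simps)
      ultimately show ?thesis
        using expandable_add_cycles[OF expandable_two_cycle[OF \<open>1 \<le> M\<close>] L'] \<open>L \<noteq> {#}\<close> by simp
    qed
  qed
  then obtain k D b where k: "depth_labelling (L + replicate_mset a 2) a k D b" "a = 0 \<or> 3 \<le> k"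
    "b \<le> e1" "k + 4 * D + 2 \<le> e"
    using e unfolding completable_def by (auto intro: order_trans)
  \<comment> \<open>Since \<open>e - k\<close> is at least \<open>4 * D + 2\<close>, the exceptional
    length \<open>4 * D + 1\<close> cannot occur.\<close>
  have "depth_labelling (L + replicate_mset a 2) a (k + (e - k)) D b"
    by (rule depth_labelling_extend[OF k(1,2)]) (use k(4) in linarith)+
  moreover have "k + (e - k) = e" using k(4) by linarith
  ultimately have "depth_labelling (L + replicate_mset a 2) a e D e1"
    using k(3) depth_labelling_mono by metis
  then show ?thesis ..
qed

section \<open>Translation to graphs\<close>

lemma path_diffs_nth: "path_diffs xs = mset (map (\<lambda>i. \<bar>xs ! i - xs ! Suc i\<bar>) [0..<length xs - 1])"
proof (induction xs rule: path_diffs.induct)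
  case (1 x y xs)
  have "[0..<length (x # y # xs) - 1] = 0 # map Suc [0..<length (y # xs) - 1]"
    by (simp add: upt_conv_Cons map_Suc_upt del: upt_Suc)
  then show ?case using 1 by (simp add: comp_def del: upt_Suc mset_upt)
qed auto

lemma cycle_diffs_nth:
  assumes "c \<noteq> []"
  shows "cycle_diffs c = mset (map (\<lambda>i. \<bar>c ! i - c ! (Suc i mod length c)\<bar>) [0..<length c])"
proof -
  have "(c @ [hd c]) ! Suc i = c ! (Suc i mod length c)" if "i < length c" for i
  proof (cases "Suc i = length c")
    case True
    then show ?thesis using assms by (simp add: hd_conv_nth nth_append)
  next
    case False
    with that have "Suc i < length c" by simp
    then show ?thesis by (simp add: nth_append)
  qed
  then have eq: "map (\<lambda>i. \<bar>(c @ [hd c]) ! i - (c @ [hd c]) ! Suc i\<bar>) [0..<length c] =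
      map (\<lambda>i. \<bar>c ! i - c ! (Suc i mod length c)\<bar>) [0..<length c]"
    by (intro map_cong refl) (simp add: nth_append)
  have len: "length (c @ [hd c]) - 1 = length c" by simp
  show ?thesis unfolding cycle_diffs_def path_diffs_nth len eq ..
qed

section \<open>Signed differences of edge multisets\<close>

lemma plus_minus_union: "plus_minus (A + B) = plus_minus A + plus_minus B"
  by (simp add: plus_minus_def)

lemma plus_minus_empty: "plus_minus {#} = {#}"
  by (simp add: plus_minus_def)

lemma edge_differences_union: "edge_differences (A + B) = edge_differences A + edge_differences B"
  by (simp add: edge_differences_def)

lemma edge_differences_empty: "edge_differences {#} = {#}"
  by (simp add: edge_differences_def)

lemma edge_differences_pairs:
  "\<forall>i\<in>set is. g i \<noteq> h i \<Longrightarrow>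
    edge_differences (mset (map (\<lambda>i. {g i, h i}) is)) = plus_minus (mset (map (\<lambda>i. \<bar>g i - h i\<bar>) is))"
proof (induction "is")
  case (Cons i "is")
  have "{(u, w). (u = g i \<or> u = h i) \<and> (w = g i \<or> w = h i) \<and> u \<noteq> w} = {(g i, h i), (h i, g i)}"
    using Cons.prems by auto
  then have "edge_differences {#{g i, h i}#} = {#g i - h i, h i - g i#}"
    using Cons.prems by (simp add: edge_differences_def)
  also have "\<dots> = plus_minus {#\<bar>g i - h i\<bar>#}"
    by (cases "h i \<le> g i") (auto simp: plus_minus_def)
  finally show ?case
    using Cons edge_differences_union[of "{#{g i, h i}#}" "mset (map (\<lambda>i. {g i, h i}) is)"]
      plus_minus_union[of "{#\<bar>g i - h i\<bar>#}" "mset (map (\<lambda>i. \<bar>g i - h i\<bar>) is)"]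
    by simp
qed (simp add: plus_minus_empty edge_differences_empty)

lemma distinct_if_mset_set:
  assumes "mset xs = mset_set A" "finite A"
  shows "distinct xs"
proof -
  have "set xs = A" using assms by (metis finite_set_mset_mset_set set_mset_mset)
  then show ?thesis using assms by (simp add: distinct_count_atmost_1 count_mset_set')
qed

text \<open>Serves to bring the cycles into the order of \<open>cycle_lengths\<close>.\<close>

lemma mset_map_permute:
  "mset (map f xs) = mset ys \<Longrightarrow> \<exists>xs'. mset xs' = mset xs \<and> map f xs' = ys"
proof (induction ys arbitrary: xs)
  case (Cons y ys)
  then have "y \<in># mset (map f xs)" by simp
  then obtain x where x: "x \<in> set xs" "f x = y" by auto
  then have "mset (map f (remove1 x xs)) = mset ys"
    using Cons.prems by (simp add: image_mset_Diff)
  then obtain xs' where "mset xs' = mset (remove1 x xs)" "map f xs' = ys"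
    using Cons.IH by blast
  then show ?case using x by (intro exI[of _ "x # xs'"]) simp
qed simp

lemma labelled_permute:
  assumes "labelled cs p lo k a" "mset cs' = mset cs"
  shows "labelled cs' p lo k a"
proof -
  have "sum_list (map f cs') = sum_list (map f cs)" for f :: "int list \<Rightarrow> int multiset"
    using assms(2) by (metis mset_map sum_mset_sum_list)
  then show ?thesis using assms(1) by (simp add: labelled_def mset_concat)
qed

lemma graceful_of_labelled:
  assumes lab: "labelled cs p lo \<epsilon> a" and a: "a \<in> {0, 1}"
    and len: "map length cs = cycle_lengths L a" and L: "\<forall>l\<in>#L. 2 \<le> l"
  shows "\<exists>\<Gamma>. graceful_labeling_of \<Gamma> L a (length p - 1) \<and> size (edges \<Gamma>) = \<epsilon> \<and>
     Delta_path \<Gamma> = plus_minus (path_diffs p)"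
proof -
  have p: "p \<noteq> []" "mset (concat cs @ p) = mset_set {lo..lo + int \<epsilon>}"
    "sum_list (map cycle_diffs cs) + path_diffs p = diff_target a \<epsilon>"
    using lab by (auto simp: labelled_def)
  define m where "m = length p - 1"
  define n where "n = length cs"
  have lp: "length p = Suc m" using p(1) by (cases p) (auto simp: m_def)
  have n: "length (cycle_lengths L a) = n" "\<And>j. j < n \<Longrightarrow> cycle_lengths L a ! j = length (cs ! j)"
    using len[symmetric] by (auto simp: n_def)
  \<comment> \<open>With two or more vertices, cyclically consecutive ones are distinct, so no edge
    collapses.\<close>
  have len2: "2 \<le> length (cs ! j)" if "j < n" for j
  proof -
    have "length (cs ! j) \<in> set (map length cs)" using that by (auto simp: n_def)
    then show ?thesis using L unfolding len by (auto simp: cycle_lengths_def split: if_splits)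
  qed
  have "distinct (concat cs @ p)"
    using p(2) by (rule distinct_if_mset_set) simp
  then have dist: "distinct p" "\<And>j. j < n \<Longrightarrow> distinct (cs ! j)"
    by (auto simp: distinct_concat_iff n_def)
  have total: "length p + (\<Sum>j<n. length (cs ! j)) = \<epsilon> + 1"
  proof -
    have "length (concat cs @ p) = size (mset_set {lo..lo + int \<epsilon>})"
      using p(2) by (metis size_mset)
    then show ?thesis
      by (simp add: length_concat sum_list_sum_nth atLeast0LessThan n_def)
  qed
  define F where "F = (\<lambda>(j, i). (if j = 0 then p ! i else cs ! (j - 1) ! i) - lo)"
  define G where "G = cycles_and_path L a m"
  define \<Gamma> where "\<Gamma> = relabel F G"
  have vG: "verts G = {0} \<times> {..m} \<union> (\<Union>j<n. {Suc j} \<times> {..<length (cs ! j)})"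
    and eG: "edges G = path_edges_of_length m + (\<Sum>j<n. cycle_edges (Suc j) (length (cs ! j)))"
    and pG: "path_edges G = path_edges_of_length m"
    using n by (simp_all add: G_def cycles_and_path_def)
  have "set (concat cs @ p) = {lo..lo + int \<epsilon>}"
    using p(2) by (metis finite_atLeastAtMost_int finite_set_mset_mset_set set_mset_mset)
  then have "(\<lambda>x. x - lo) ` ((\<Union>c\<in>set cs. set c) \<union> set p) = (\<lambda>x. x - lo) ` {lo..lo + int \<epsilon>}"
    by simp
  also have "\<dots> = {0..int \<epsilon>}" by simp
  also have "(\<lambda>x. x - lo) ` ((\<Union>c\<in>set cs. set c) \<union> set p) = F ` verts G"
  proof -
    have "F ` ({0} \<times> {..m}) = (\<lambda>x. x - lo) ` set p"
      using lp by (auto simp: F_def image_iff set_conv_nth less_Suc_eq_le)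
    moreover have "F ` ({Suc j} \<times> {..<length (cs ! j)}) = (\<lambda>x. x - lo) ` set (cs ! j)" for j
      by (auto simp: F_def image_iff set_conv_nth)
    moreover have "set cs = (\<lambda>j. cs ! j) ` {..<n}"
      by (auto simp: n_def set_conv_nth)
    then have "(\<Union>c\<in>set cs. set c) = (\<Union>j<n. set (cs ! j))" by simp
    ultimately show ?thesis by (simp add: vG image_Un image_UN Un_commute)
  qed
  finally have img: "F ` verts G = {0..int \<epsilon>}" .
  have fin: "finite (verts G)" by (simp add: vG)
  \<comment> \<open>Injectivity by counting: the model has at most \<open>\<epsilon> + 1\<close>
    vertices and its image has exactly that many.\<close>
  have "card (verts G) \<le> card ({0::nat} \<times> {..m}) + card (\<Union>j<n. {Suc j} \<times> {..<length (cs ! j)})"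
    unfolding vG by (rule card_Un_le)
  also have "\<dots> \<le> card ({0::nat} \<times> {..m}) + (\<Sum>j<n. card ({Suc j} \<times> {..<length (cs ! j)}))"
    by (intro add_left_mono card_UN_le) simp
  also have "\<dots> = card (F ` verts G)" using total lp by (simp add: img)
  finally have inj: "inj_on F (verts G)"
    using fin card_image_le[OF fin, of F] by (intro eq_card_imp_inj_on) auto
  define h where "h = (\<lambda>X. edge_differences (image_mset (image F) X))"
  have h: "h {#} = {#}" "\<And>X Y. h (X + Y) = h X + h Y"
    by (simp_all add: h_def edge_differences_union edge_differences_empty)
  have hp: "h (path_edges_of_length m) = plus_minus (path_diffs p)"
  proof -
    have "image_mset (image F) (path_edges_of_length m) = mset (map (\<lambda>i. {F (0, i), F (0, Suc i)}) [0..<m])"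
      by (simp add: path_edges_of_length_def image_mset.compositionality comp_def lessThan_atLeast0)
    moreover have "\<forall>i\<in>set [0..<m]. F (0, i) \<noteq> F (0, Suc i)"
      using dist(1) lp by (auto simp: F_def nth_eq_iff_index_eq)
    ultimately show ?thesis
      using edge_differences_pairs[of "[0..<m]" "\<lambda>i. F (0, i)" "\<lambda>i. F (0, Suc i)"]
      by (simp add: h_def F_def path_diffs_nth m_def)
  qed
  have hc: "h (cycle_edges (Suc j) (length (cs ! j))) = plus_minus (cycle_diffs (cs ! j))" if j: "j < n" for j
  proof -
    define l where "l = length (cs ! j)"
    have l: "2 \<le> l" using len2[OF j] by (simp add: l_def)
    have "image_mset (image F) (cycle_edges (Suc j) l) =
        mset (map (\<lambda>i. {F (Suc j, i), F (Suc j, Suc i mod l)}) [0..<l])"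
      by (simp add: cycle_edges_def image_mset.compositionality comp_def lessThan_atLeast0)
    moreover have "\<forall>i\<in>set [0..<l]. F (Suc j, i) \<noteq> F (Suc j, Suc i mod l)"
      using dist(2)[OF j] l by (auto simp: F_def nth_eq_iff_index_eq l_def mod_if)
    moreover have "cs ! j \<noteq> []" using l by (auto simp: l_def)
    ultimately show ?thesis
      using edge_differences_pairs[of "[0..<l]" "\<lambda>i. F (Suc j, i)" "\<lambda>i. F (Suc j, Suc i mod l)"]
      by (simp add: h_def F_def l_def cycle_diffs_nth)
  qed
  have "Delta \<Gamma> = h (edges G)"
    by (simp add: Delta_def \<Gamma>_def relabel_def h_def)
  also have "\<dots> = h (path_edges_of_length m) + h (\<Sum>j<n. cycle_edges (Suc j) (length (cs ! j)))"
    unfolding eG by (rule h(2))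
  also have "h (\<Sum>j<n. cycle_edges (Suc j) (length (cs ! j))) =
      (\<Sum>j<n. h (cycle_edges (Suc j) (length (cs ! j))))"
    using sum_comp_morphism[OF h, of "\<lambda>j. cycle_edges (Suc j) (length (cs ! j))" "{..<n}"]
    unfolding comp_def by (rule sym)
  also have "\<dots> = (\<Sum>j<n. plus_minus (cycle_diffs (cs ! j)))"
    by (rule sum.cong[OF refl]) (rule hc, simp)
  also have "\<dots> = plus_minus (\<Sum>j<n. cycle_diffs (cs ! j))"
    using sum_comp_morphism[OF plus_minus_empty plus_minus_union, of "\<lambda>j. cycle_diffs (cs ! j)" "{..<n}"]
    unfolding comp_def .
  also have "(\<Sum>j<n. cycle_diffs (cs ! j)) = sum_list (map cycle_diffs cs)"
    by (simp add: sum_list_sum_nth atLeast0LessThan n_def)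
  finally have "Delta \<Gamma> = plus_minus (diff_target a \<epsilon>)"
    unfolding hp by (simp add: p(3)[symmetric] plus_minus_union)
  moreover have "Delta_path \<Gamma> = plus_minus (path_diffs p)"
    using hp by (simp add: Delta_path_def \<Gamma>_def relabel_def pG h_def)
  moreover have "size (edges \<Gamma>) = \<epsilon>"
    using total lp by (simp add: \<Gamma>_def relabel_def eG path_edges_of_length_def cycle_edges_def)
  moreover have "verts \<Gamma> = {0..int \<epsilon>}" using img by (simp add: \<Gamma>_def relabel_def)
  moreover have "labeling_of \<Gamma> G" using inj by (auto simp: labeling_of_def \<Gamma>_def)
  ultimately have "graceful_labeling_of \<Gamma> L a m"
    using a unfolding graceful_labeling_of_def Let_def G_def diff_target_def
    by (cases "a = 0") (simp_all add: plus_minus_def)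
  then show ?thesis
    using \<open>Delta_path \<Gamma> = _\<close> \<open>size (edges \<Gamma>) = \<epsilon>\<close> by (auto simp: m_def)
qed

text \<open>Above 3 every difference occurs just once in the target, even with a 2-cycle; those
  above \<open>b\<close> are not on a cycle, so they are on the path.\<close>

lemma large_diffs_on_path:
  assumes "labelled cs p lo k a" "3 \<le> b"
    and "\<forall>c\<in>set cs. \<forall>x\<in>#cycle_diffs c. x \<le> int b"
  shows "mset_set {int b + 1..int k} \<subseteq># plus_minus (path_diffs p)"
proof -
  have p: "sum_list (map cycle_diffs cs) + path_diffs p = diff_target a k"
    using assms(1) by (auto simp: labelled_def)
  have "mset_set {int b + 1..int k} \<subseteq># path_diffs p"
  proof (rule mset_subset_eqI)
    fix x
    show "count (mset_set {int b + 1..int k}) x \<le> count (path_diffs p) x"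
    proof (cases "x \<in> {int b + 1..int k}")
      case True
      have "x \<notin># sum_list (map cycle_diffs cs)"
        using assms(3) True by (induction cs) fastforce+
      then have "count (sum_list (map cycle_diffs cs)) x = 0" by (rule not_in_iff[THEN iffD1])
      then have "count (path_diffs p) x = count (diff_target a k) x"
        using arg_cong[OF p, of "\<lambda>M. count M x"] unfolding count_union by linarith
      also have "\<dots> = 1" using True assms(2) by (auto simp: diff_target_def count_mset_set')
      finally show ?thesis using True by simp
    qed simp
  qed
  then show ?thesis unfolding plus_minus_def by (rule subset_mset.order_trans) simp
qed

theorem theorem5p8:
  fixes L :: "nat multiset" and a \<epsilon>\<^sub>1 \<epsilon> :: nat
  assumes "\<forall>l\<in>#L. odd l \<and> l > 1"
    and "a \<in> {0, 1}"
    and "\<epsilon>\<^sub>1 = (if L = {#} then 3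
               else 7 ^ (size L + a - 1) * (2 * Max (set_mset L) + 1))"
    and "\<epsilon> \<ge> 3 * \<epsilon>\<^sub>1"
  shows "\<exists>\<Gamma>. graceful_labeling_of \<Gamma> L a (\<epsilon> - (\<Sum>l\<in>#L. l) - 2 * a) \<and>
             size (edges \<Gamma>) = \<epsilon> \<and>
             mset_set {int \<epsilon>\<^sub>1 + 1..int \<epsilon>} \<subseteq># Delta_path \<Gamma>"
proof -
  have "3 \<le> \<epsilon>\<^sub>1"
  proof (cases "L = {#}")
    case False
    then have "Max (set_mset L) > 1" using assms(1) by simp
    then have "3 \<le> 2 * Max (set_mset L) + 1" by linarith
    also have "\<dots> \<le> 7 ^ (size L + a - 1) * (2 * Max (set_mset L) + 1)"
      using mult_le_mono1[of 1 "7 ^ (size L + a - 1)" "2 * Max (set_mset L) + 1"] by simp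
    finally show ?thesis using False assms(3) by simp
  qed (use assms(3) in simp)
  obtain D where "depth_labelling (L + replicate_mset a 2) a \<epsilon> D \<epsilon>\<^sub>1"
    using depth_labelling_exists[OF assms] by auto
  then obtain cs p lo where cs: "labelled cs p lo \<epsilon> a" "mset (map length cs) = L + replicate_mset a 2"
    "\<forall>c\<in>set cs. \<forall>x\<in>#cycle_diffs c. x \<le> int \<epsilon>\<^sub>1"
    unfolding depth_labelling_def by blast
  have "mset (map length cs) = mset (cycle_lengths L a)"
    using cs(2) by (simp add: cycle_lengths_def)
  then obtain cs' where cs': "mset cs' = mset cs" "map length cs' = cycle_lengths L a"
    using mset_map_permute by metis
  then have lab: "labelled cs' p lo \<epsilon> a" using labelled_permute[OF cs(1)] by blast
  \<comment> \<open>Counting the \<open>\<epsilon> + 1\<close> vertices determines the number of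
    path edges.\<close>
  have "length (concat cs' @ p) = size (mset_set {lo..lo + int \<epsilon>})"
    using lab unfolding labelled_def by (metis size_mset)
  moreover have "length (concat cs') = (\<Sum>l\<in>#L. l) + 2 * a"
    using cs'(2) by (simp add: length_concat cycle_lengths_def sum_list_replicate flip: sum_mset_sum_list)
  ultimately have "length p - 1 = \<epsilon> - (\<Sum>l\<in>#L. l) - 2 * a" by simp
  moreover have "\<forall>l\<in>#L. 2 \<le> l" using assms(1) by auto
  moreover have "mset_set {int \<epsilon>\<^sub>1 + 1..int \<epsilon>} \<subseteq># plus_minus (path_diffs p)"
    using large_diffs_on_path[OF cs(1) \<open>3 \<le> \<epsilon>\<^sub>1\<close> cs(3)] .
  ultimately show ?thesis
    using graceful_of_labelled[OF lab assms(2) cs'(2)] by auto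
qed

end
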